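(* Let $s\ge 1$ and let $(X,d)$ be a complete $b$-metric space with constant $s$ and with $|X|\ge 3$. Let $T:X\to X$ be a paired-Kannan contraction, i.e. there exists a real constant $\alpha$ with $\alpha<\frac12$ if $1\le s\le 2$ and $\alpha<\frac1s$ if $s>2$ (equivalently $\alpha<\min\{\frac12,\frac1s\}$) such that $$d(Tx,Ty)+d(Ty,Tz)\le \alpha\bigl(d(x,Tx)+d(y,Ty)+d(z,Tz)\bigr)$$ for all pairwise distinct $x,y,z\in X$. Then $T$ has a fixed point in $X$ if and only if $T$ has no periodic points of prime period $2$. Moreover, the number of fixed points of $T$ is at most two.
   Context: A $b$-metric with constant $s\ge 1$ on a nonempty set $X$ is a function $d:X\times X\to[0,\infty)$ such that for all $x,y,z\in X$: (a) $d(x,y)=0$ iff $x=y$; (b) $d(x,y)=d(y,x)$; (c) $d(x,z)\le s[d(x,y)+d(y,z)]$. A sequence $\{x_n\}$ converges to $x$ if $d(x_n,x)\to 0$; it is Cauchy if $d(x_n,x_m)\to 0$ as $n,m\to\infty$; $(X,d)$ is complete if every Cauchy sequence converges to a point of $X$. A fixed point of $T$ is a point $x$ with $Tx=x$. A periodic point of prime period $2$ is a point $y\in X$ with $T(Ty)=y$ and $Ty\ne y$. *)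

theory Defs
  imports Complex_Main "HOL-Library.FuncSet"
begin

text \<open>The space is a carrier set \<open>X\<close> in an arbitrary type; \<open>d\<close> and self-maps of \<open>X\<close> are
  total functions about which nothing is assumed outside \<open>X\<close>.\<close>

definition b_metric_on :: "real \<Rightarrow> 'a set \<Rightarrow> ('a \<Rightarrow> 'a \<Rightarrow> real) \<Rightarrow> bool" where
  "b_metric_on s X d \<longleftrightarrow>
     s \<ge> 1 \<and> X \<noteq> {} \<and>
     (\<forall>x\<in>X. \<forall>y\<in>X. d x y \<ge> 0) \<and>
     (\<forall>x\<in>X. \<forall>y\<in>X. d x y = 0 \<longleftrightarrow> x = y) \<and>
     (\<forall>x\<in>X. \<forall>y\<in>X. d x y = d y x) \<and>
     (\<forall>x\<in>X. \<forall>y\<in>X. \<forall>z\<in>X. d x z \<le> s * (d x y + d y z))"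

definition b_convergent_to :: "('a \<Rightarrow> 'a \<Rightarrow> real) \<Rightarrow> (nat \<Rightarrow> 'a) \<Rightarrow> 'a \<Rightarrow> bool" where
  "b_convergent_to d u x \<longleftrightarrow> (\<lambda>n. d (u n) x) \<longlonglongrightarrow> 0"

definition b_Cauchy :: "('a \<Rightarrow> 'a \<Rightarrow> real) \<Rightarrow> (nat \<Rightarrow> 'a) \<Rightarrow> bool" where
  "b_Cauchy d u \<longleftrightarrow> (\<forall>e>0. \<exists>N. \<forall>n\<ge>N. \<forall>m\<ge>N. d (u n) (u m) < e)"

definition b_complete_on :: "'a set \<Rightarrow> ('a \<Rightarrow> 'a \<Rightarrow> real) \<Rightarrow> bool" where
  "b_complete_on X d \<longleftrightarrow>
     (\<forall>u. range u \<subseteq> X \<and> b_Cauchy d u \<longrightarrow> (\<exists>x\<in>X. b_convergent_to d u x))"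

definition paired_Kannan :: "real \<Rightarrow> 'a set \<Rightarrow> ('a \<Rightarrow> 'a \<Rightarrow> real) \<Rightarrow> ('a \<Rightarrow> 'a) \<Rightarrow> bool" where
  "paired_Kannan s X d T \<longleftrightarrow>
     (\<exists>\<alpha>::real.
        (1 \<le> s \<and> s \<le> 2 \<longrightarrow> \<alpha> < 1 / 2) \<and> (s > 2 \<longrightarrow> \<alpha> < 1 / s) \<and>
        (\<forall>x\<in>X. \<forall>y\<in>X. \<forall>z\<in>X. x \<noteq> y \<and> y \<noteq> z \<and> x \<noteq> z \<longrightarrow>
           d (T x) (T y) + d (T y) (T z) \<le> \<alpha> * (d x (T x) + d y (T y) + d z (T z))))"

definition fixed_points :: "'a set \<Rightarrow> ('a \<Rightarrow> 'a) \<Rightarrow> 'a set" where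
  "fixed_points X T = {x \<in> X. T x = x}"

definition prime_period_2_points :: "'a set \<Rightarrow> ('a \<Rightarrow> 'a) \<Rightarrow> 'a set" where
  "prime_period_2_points X T = {y \<in> X. T (T y) = y \<and> T y \<noteq> y}"

end

theory Submission
  imports Defs
begin

text \<open>
  A fixed point \<open>p\<close> and a 2-cycle \<open>{y, T y}\<close> cannot coexist: the contraction inequality for
  \<open>p, y, T y\<close> bounds \<open>d y (T y)\<close> by \<open>2 * \<alpha> * d y (T y)\<close>, and \<open>2 * \<alpha> < 1\<close>. For three distinct
  fixed points the right-hand side of the inequality vanishes, so there are at most two.

  For existence, suppose that \<open>T\<close> has neither fixed points nor 2-cycles. Then any three
  consecutive points of an orbit are pairwise distinct, so the inequality applies to them and
  makes the step lengths \<open>a n\<close> decay geometrically (lemma \<open>orbit_step_contraction\<close>). Strict decay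
  makes the orbit injective, and now the inequality can be used a second time, on orbit points far
  apart: as a Kannan condition, it bounds the distance of two images by step lengths alone. Hence
  the orbit is Cauchy, and the \<open>b\<close>-triangle inequality, whose iteration would cost powers of
  \<open>s\<close>, is not involved in that step. It is used just once, to compare the limit \<open>p\<close> with \<open>T p\<close>;
  this costs one factor \<open>s\<close>, and \<open>s * \<alpha> < 1\<close> is exactly what absorbs it.
\<close>

section \<open>The contraction constant\<close>

text \<open>The case distinction on \<open>s\<close> serves to give the two bounds \<open>\<alpha> < 1 / 2\<close> and \<open>s * \<alpha> < 1\<close>
  simultaneously. A negative constant may be raised to \<open>0\<close>, since distances are nonnegative.\<close>

lemma paired_Kannan_constant:
  assumes b: "b_metric_on s X d" and T: "T \<in> X \<rightarrow> X" and K: "paired_Kannan s X d T"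
  obtains \<alpha> where "0 \<le> \<alpha>" "\<alpha> < 1 / 2" "s * \<alpha> < 1"
    "\<And>x y z. \<lbrakk>x \<in> X; y \<in> X; z \<in> X; x \<noteq> y; y \<noteq> z; x \<noteq> z\<rbrakk> \<Longrightarrow>
       d (T x) (T y) + d (T y) (T z) \<le> \<alpha> * (d x (T x) + d y (T y) + d z (T z))"
proof -
  have s: "s \<ge> 1" and nonneg: "\<And>x. x \<in> X \<Longrightarrow> d x (T x) \<ge> 0"
    using b T by (auto simp: b_metric_on_def)
  obtain \<beta> where b1: "s \<le> 2 \<Longrightarrow> \<beta> < 1 / 2" and b2: "s > 2 \<Longrightarrow> \<beta> < 1 / s"
    and ineq: "\<And>x y z. \<lbrakk>x \<in> X; y \<in> X; z \<in> X; x \<noteq> y; y \<noteq> z; x \<noteq> z\<rbrakk> \<Longrightarrow>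
       d (T x) (T y) + d (T y) (T z) \<le> \<beta> * (d x (T x) + d y (T y) + d z (T z))"
    using K s unfolding paired_Kannan_def by blast
  have half: "\<beta> < 1 / 2"
  proof (cases "s \<le> 2")
    case False
    then have "1 / s \<le> 1 / 2" by (intro divide_left_mono) auto
    with b2 False show ?thesis by linarith
  qed (rule b1)
  have s\<beta>: "s * max 0 \<beta> < 1"
  proof (cases "s \<le> 2")
    case True
    then have "s * max 0 \<beta> \<le> 2 * max 0 \<beta>" by (intro mult_right_mono) auto
    with half show ?thesis by simp
  next
    case False
    with b2 have "max 0 \<beta> < 1 / s" by simp
    then show ?thesis using s by (simp add: less_divide_eq mult.commute)
  qed
  show ?thesis
  proof (rule that[of "max 0 \<beta>"])
    fix x y z assume X: "x \<in> X" "y \<in> X" "z \<in> X" and ne: "x \<noteq> y" "y \<noteq> z" "x \<noteq> z"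
    have "\<beta> * (d x (T x) + d y (T y) + d z (T z))
        \<le> max 0 \<beta> * (d x (T x) + d y (T y) + d z (T z))"
      using nonneg X by (intro mult_right_mono) auto
    with ineq[OF X ne]
    show "d (T x) (T y) + d (T y) (T z) \<le> max 0 \<beta> * (d x (T x) + d y (T y) + d z (T z))"
      by linarith
  qed (use half s\<beta> in auto)
qed

section \<open>Fixed points, 2-cycles and orbit limits\<close>

lemma finite_card_le_2_if_no_three_distinct:
  assumes "\<And>x y z. \<lbrakk>x \<in> A; y \<in> A; z \<in> A; x \<noteq> y; y \<noteq> z; x \<noteq> z\<rbrakk> \<Longrightarrow> False"
  shows "finite A \<and> card A \<le> 2"
proof (rule ccontr)
  assume "\<not> (finite A \<and> card A \<le> 2)"
  then have "infinite A \<or> 3 \<le> card A" by auto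
  then obtain B where "B \<subseteq> A" "card B = 3"
    by (metis infinite_arbitrarily_large obtain_subset_with_card_n)
  then show False using assms by (auto simp: card_3_iff)
qed

locale paired_Kannan_map =
  fixes s \<alpha> :: real and X :: "'a set" and d :: "'a \<Rightarrow> 'a \<Rightarrow> real" and T :: "'a \<Rightarrow> 'a"
  assumes b_metric: "b_metric_on s X d"
    and maps: "T \<in> X \<rightarrow> X"
    and alpha_nonneg: "0 \<le> \<alpha>" and alpha_half: "\<alpha> < 1 / 2" and alpha_s: "s * \<alpha> < 1"
    and contraction: "\<lbrakk>x \<in> X; y \<in> X; z \<in> X; x \<noteq> y; y \<noteq> z; x \<noteq> z\<rbrakk> \<Longrightarrow>
       d (T x) (T y) + d (T y) (T z) \<le> \<alpha> * (d x (T x) + d y (T y) + d z (T z))"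
begin

lemma T_in: "x \<in> X \<Longrightarrow> T x \<in> X"
  using maps by auto

lemma nonneg: "x \<in> X \<Longrightarrow> y \<in> X \<Longrightarrow> 0 \<le> d x y"
  and zero_iff: "x \<in> X \<Longrightarrow> y \<in> X \<Longrightarrow> d x y = 0 \<longleftrightarrow> x = y"
  and commute: "x \<in> X \<Longrightarrow> y \<in> X \<Longrightarrow> d x y = d y x"
  and triangle: "x \<in> X \<Longrightarrow> y \<in> X \<Longrightarrow> z \<in> X \<Longrightarrow> d x z \<le> s * (d x y + d y z)"
  and s_ge_1: "1 \<le> s"
  using b_metric by (auto simp: b_metric_on_def)

lemma pos: "x \<in> X \<Longrightarrow> y \<in> X \<Longrightarrow> x \<noteq> y \<Longrightarrow> 0 < d x y"
  using nonneg zero_iff by (metis less_eq_real_def)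

lemma fixed_points_at_most_two: "finite (fixed_points X T) \<and> card (fixed_points X T) \<le> 2"
proof (rule finite_card_le_2_if_no_three_distinct)
  fix x y z
  assume "x \<in> fixed_points X T" "y \<in> fixed_points X T" "z \<in> fixed_points X T"
    and ne: "x \<noteq> y" "y \<noteq> z" "x \<noteq> z"
  then have X: "x \<in> X" "y \<in> X" "z \<in> X" and fp: "T x = x" "T y = y" "T z = z"
    by (auto simp: fixed_points_def)
  have "d x y + d y z \<le> 0"
    using contraction[OF X ne] zero_iff[OF X(1) X(1)] zero_iff[OF X(2) X(2)] zero_iff[OF X(3) X(3)]
    by (simp add: fp)
  then show False using pos X ne by (meson add_pos_pos not_less)
qed

lemma no_period_2_if_fixed_point:
  assumes p: "p \<in> X" "T p = p" and y: "y \<in> X" "T (T y) = y" "T y \<noteq> y"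
  shows False
proof -
  have ne: "p \<noteq> y" "y \<noteq> T y" "p \<noteq> T y" using p y by auto
  \<comment> \<open>With \<open>y\<close> in the middle position, the cycle's own length appears on the left-hand side.\<close>
  have "d p (T y) + d (T y) y \<le> \<alpha> * (d p p + d y (T y) + d (T y) y)"
    using contraction[of p y "T y"] p y ne T_in by simp
  moreover have "d p p = 0" "d (T y) y = d y (T y)"
    using p y T_in zero_iff commute by auto
  ultimately have "d p (T y) + d y (T y) \<le> (2 * \<alpha>) * d y (T y)"
    by simp
  moreover have "(2 * \<alpha>) * d y (T y) < 1 * d y (T y)"
    using alpha_half pos y ne T_in by (intro mult_strict_right_mono) auto
  ultimately show False using nonneg[of p "T y"] p y T_in by simp
qed

text \<open>The inequality speaks of distinct points only; injectivity makes \<open>u\<close> miss \<open>p\<close> from some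
  index on, so that it applies to \<open>p, u n, u (n+1)\<close>. It bounds \<open>d (T p) (u (n+1))\<close> by
  \<open>\<alpha> * d p (T p)\<close> up to a null sequence, and the \<open>b\<close>-triangle inequality through \<open>u (n+1)\<close>
  then bounds \<open>d p (T p)\<close> by \<open>s * \<alpha> * d p (T p)\<close>.\<close>

lemma fixed_point_if_orbit_limit:
  assumes u: "\<And>n. u n \<in> X" "\<And>n. u (Suc n) = T (u n)" and inj: "inj u"
    and null: "(\<lambda>n. d (u n) (u (Suc n))) \<longlonglongrightarrow> 0"
    and p: "p \<in> X" and lim: "b_convergent_to d u p"
  shows "T p = p"
proof (rule ccontr)
  assume "T p \<noteq> p"
  then have pos_p: "0 < d p (T p)" using pos p T_in by auto
  let ?a = "\<lambda>n. d (u n) (u (Suc n))"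
  let ?bound = "\<lambda>n. s * (d (u (Suc n)) p + \<alpha> * (d p (T p) + ?a n + ?a (Suc n)))"
  have "finite (u -` {p})" using inj by (intro finite_vimageI) auto
  then obtain N where N: "\<And>n. u n = p \<Longrightarrow> n \<le> N"
    using finite_nat_set_iff_bounded_le by auto
  have "d p (T p) \<le> ?bound n" if "n > N" for n
  proof -
    have ne: "p \<noteq> u n" "p \<noteq> u (Suc n)" using N[of n] N[of "Suc n"] that by auto
    have "u n \<noteq> u (Suc n)" using inj by (auto dest: injD)
    then have "d (T p) (u (Suc n)) + ?a (Suc n) \<le> \<alpha> * (d p (T p) + ?a n + ?a (Suc n))"
      using contraction[of p "u n" "u (Suc n)"] p u(1) ne by (simp flip: u(2))
    moreover have "0 \<le> ?a (Suc n)" by (intro nonneg u(1))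
    moreover have "d (u (Suc n)) (T p) = d (T p) (u (Suc n))"
      "d p (u (Suc n)) = d (u (Suc n)) p"
      using commute p u(1) T_in by blast+
    ultimately have "d p (u (Suc n)) + d (u (Suc n)) (T p)
        \<le> d (u (Suc n)) p + \<alpha> * (d p (T p) + ?a n + ?a (Suc n))"
      by linarith
    then have "s * (d p (u (Suc n)) + d (u (Suc n)) (T p)) \<le> ?bound n"
      using s_ge_1 by (intro mult_left_mono) auto
    with triangle[OF p u(1)[of "Suc n"] T_in[OF p]] show ?thesis by linarith
  qed
  then have ev: "\<forall>\<^sub>F n in sequentially. d p (T p) \<le> ?bound n"
    by (intro eventually_sequentiallyI[of "Suc N"]) simp
  have "(\<lambda>n. d (u (Suc n)) p) \<longlonglongrightarrow> 0"
    using lim unfolding b_convergent_to_def by (rule LIMSEQ_Suc)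
  then have "?bound \<longlonglongrightarrow> s * (0 + \<alpha> * (d p (T p) + 0 + 0))"
    using null LIMSEQ_Suc[OF null] by (intro tendsto_intros) auto
  then have "d p (T p) \<le> s * (0 + \<alpha> * (d p (T p) + 0 + 0))"
    using ev by (rule tendsto_lowerbound) simp
  then have "1 * d p (T p) \<le> (s * \<alpha>) * d p (T p)" by simp
  moreover have "(s * \<alpha>) * d p (T p) < 1 * d p (T p)"
    using alpha_s pos_p by (rule mult_strict_right_mono)
  ultimately show False by linarith
qed

end

section \<open>Orbits of a map without fixed points and 2-cycles\<close>

locale aperiodic_orbit = paired_Kannan_map +
  fixes u :: "nat \<Rightarrow> 'a"
  assumes no_fixed: "x \<in> X \<Longrightarrow> T x \<noteq> x"
    and no_period_2: "x \<in> X \<Longrightarrow> T (T x) \<noteq> x"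
    and orbit_in: "u n \<in> X"
    and orbit_Suc: "u (Suc n) = T (u n)"
begin

abbreviation a :: "nat \<Rightarrow> real" where
  "a n \<equiv> d (u n) (u (Suc n))"

lemma step_pos: "0 < a n"
  using pos[OF orbit_in orbit_in] no_fixed[OF orbit_in] orbit_Suc by metis

text \<open>The rate comes from \<open>a (n+1) + a (n+2) \<le> \<alpha> * (a n + a (n+1) + a (n+2))\<close>: collecting
  terms gives \<open>(1 - \<alpha>) * (a (n+1) + a (n+2)) \<le> \<alpha> * a n\<close>, and \<open>\<alpha> / (1 - \<alpha>) < 1\<close> if
  \<open>\<alpha> < 1 / 2\<close>.\<close>

lemma orbit_step_contraction: "a (Suc n) \<le> (\<alpha> / (1 - \<alpha>)) * a n"
proof -
  have "a (Suc n) + a (Suc (Suc n)) \<le> \<alpha> * (a n + a (Suc n) + a (Suc (Suc n)))"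
    using contraction[of "u n" "T (u n)" "T (T (u n))"]
      orbit_in[of n] T_in no_fixed no_period_2[of "u n"]
    by (simp add: orbit_Suc eq_commute[of "u n"] eq_commute[of "T (u n)" "T (T (u n))"])
  then have "(1 - \<alpha>) * a (Suc n) + (1 - \<alpha>) * a (Suc (Suc n)) \<le> \<alpha> * a n"
    by (simp add: algebra_simps)
  moreover have "0 \<le> (1 - \<alpha>) * a (Suc (Suc n))"
    using alpha_half step_pos[of "Suc (Suc n)"] by simp
  ultimately have "(1 - \<alpha>) * a (Suc n) \<le> \<alpha> * a n"
    by linarith
  then show ?thesis using alpha_half by (simp add: field_simps)
qed

lemma rate_bounds: "0 \<le> \<alpha> / (1 - \<alpha>)" "\<alpha> / (1 - \<alpha>) < 1"
  using alpha_nonneg alpha_half by (auto simp: field_simps)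

lemma steps_tendsto_0: "a \<longlonglongrightarrow> 0"
proof -
  let ?k = "\<alpha> / (1 - \<alpha>)"
  have bound: "a n \<le> a 0 * ?k ^ n" for n
  proof (induction n)
    case (Suc n)
    have "a (Suc n) \<le> ?k * a n" by (rule orbit_step_contraction)
    also have "\<dots> \<le> ?k * (a 0 * ?k ^ n)"
      using Suc rate_bounds by (intro mult_left_mono) auto
    finally show ?case by (simp add: mult_ac)
  qed simp
  have "(\<lambda>n. ?k ^ n) \<longlonglongrightarrow> 0"
    using rate_bounds by (intro LIMSEQ_realpow_zero)
  then have "(\<lambda>n. a 0 * ?k ^ n) \<longlonglongrightarrow> 0"
    by (rule tendsto_mult_right_zero)
  then show ?thesis
    using bound step_pos
    by (intro tendsto_sandwich[where f = "\<lambda>_. 0" and g = a]) (auto simp: less_imp_le)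
qed

text \<open>The step length at a point depends only on that point, and it strictly decreases along the
  orbit.\<close>

lemma orbit_inj: "inj u"
proof -
  have "a (Suc n) < a n" for n
  proof -
    have "(\<alpha> / (1 - \<alpha>)) * a n < 1 * a n"
      using rate_bounds step_pos by (intro mult_strict_right_mono)
    with orbit_step_contraction[of n] show ?thesis by linarith
  qed
  then have less: "a n < a m" if "m < n" for m n
    using that by (rule lift_Suc_mono_less[where f = "\<lambda>n. - a n", simplified])
  have "a m = a n" if "u m = u n" for m n
    using that by (simp add: orbit_Suc)
  with less show ?thesis
    by (metis injI less_irrefl linorder_neqE_nat)
qed

text \<open>For \<open>m < n\<close>, the inequality for \<open>u m, u n, u (n+1)\<close> bounds \<open>d (u (m+1)) (u (n+1))\<close> by
  \<open>\<alpha>\<close> times three step lengths with indices at least \<open>m\<close>.\<close>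

lemma orbit_Cauchy: "b_Cauchy d u"
  unfolding b_Cauchy_def
proof (intro allI impI)
  fix e :: real assume "e > 0"
  then obtain N where N: "\<And>n. n \<ge> N \<Longrightarrow> a n < e / 3"
    using order_tendstoD(2)[OF steps_tendsto_0, of "e / 3"]
    by (auto simp: eventually_sequentially)
  have close: "d (u (Suc m)) (u (Suc n)) < e" if "N \<le> m" "m < n" for m n
  proof -
    have ne: "u m \<noteq> u n" "u n \<noteq> u (Suc n)" "u m \<noteq> u (Suc n)"
      using that orbit_inj by (auto dest: injD)
    have "d (u (Suc m)) (u (Suc n)) + a (Suc n) \<le> \<alpha> * (a m + a n + a (Suc n))"
      using contraction[OF orbit_in orbit_in orbit_in ne] by (simp flip: orbit_Suc)
    also have "\<dots> \<le> 1 * (a m + a n + a (Suc n))"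
      using alpha_half step_pos[of m] step_pos[of n] step_pos[of "Suc n"]
      by (intro mult_right_mono) linarith+
    finally have "d (u (Suc m)) (u (Suc n)) + a (Suc n) \<le> 1 * (a m + a n + a (Suc n))" .
    moreover have "a m < e / 3" "a n < e / 3" "a (Suc n) < e / 3"
      using that by (intro N; simp)+
    ultimately show ?thesis
      using \<open>e > 0\<close> by simp
  qed
  have "d (u n) (u m) < e" if "Suc N \<le> n" "Suc N \<le> m" for n m
  proof -
    obtain n' m' where nm: "n = Suc n'" "m = Suc m'" "N \<le> n'" "N \<le> m'"
      using \<open>Suc N \<le> n\<close> \<open>Suc N \<le> m\<close> by (cases n; cases m) auto
    consider "n' < m'" | "m' < n'" | "n' = m'" by linarith
    then show ?thesis
    proof cases
      case 2
      then show ?thesis using close[of m' n'] nm commute[of "u n" "u m", OF orbit_in orbit_in] by simp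
    next
      case 3
      then show ?thesis using nm zero_iff[of "u n" "u n", OF orbit_in orbit_in] \<open>e > 0\<close> by simp
    qed (use close nm in auto)
  qed
  then show "\<exists>N. \<forall>n\<ge>N. \<forall>m\<ge>N. d (u n) (u m) < e" by blast
qed

lemma not_complete: "\<not> b_complete_on X d"
proof
  assume "b_complete_on X d"
  then obtain p where p: "p \<in> X" "b_convergent_to d u p"
    using orbit_Cauchy orbit_in unfolding b_complete_on_def by (meson image_subsetI)
  then have "T p = p"
    by (rule fixed_point_if_orbit_limit[of u, OF orbit_in orbit_Suc orbit_inj steps_tendsto_0])
  with no_fixed[OF p(1)] show False by contradiction
qed

end

section \<open>Existence of fixed points and the dichotomy\<close>

lemma (in paired_Kannan_map) fixed_point_if_no_period_2:
  assumes complete: "b_complete_on X d"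
    and no2: "\<And>y. y \<in> X \<Longrightarrow> T (T y) = y \<Longrightarrow> T y = y"
  shows "\<exists>p\<in>X. T p = p"
proof (rule ccontr)
  assume nofix: "\<not> (\<exists>p\<in>X. T p = p)"
  obtain x where x: "x \<in> X" using b_metric unfolding b_metric_on_def by blast
  have orbit: "(T ^^ n) x \<in> X" for n
    using x by (induction n) (auto intro: T_in)
  interpret aperiodic_orbit s \<alpha> X d T "\<lambda>n. (T ^^ n) x"
  proof unfold_locales
    show "T y \<noteq> y" "T (T y) \<noteq> y" if "y \<in> X" for y
      using that nofix no2 by blast+
  qed (simp_all add: orbit)
  show False using not_complete complete by blast
qed

theorem theorem5p5:
  fixes s :: real and X :: "'a set" and d :: "'a \<Rightarrow> 'a \<Rightarrow> real" and T :: "'a \<Rightarrow> 'a"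
  assumes "b_metric_on s X d"
    and "b_complete_on X d"
    and "infinite X \<or> card X \<ge> 3"
    and "T \<in> X \<rightarrow> X"
    and "paired_Kannan s X d T"
  shows "(fixed_points X T \<noteq> {} \<longleftrightarrow> prime_period_2_points X T = {}) \<and>
         finite (fixed_points X T) \<and> card (fixed_points X T) \<le> 2"
proof -
  obtain \<alpha> where \<alpha>: "0 \<le> \<alpha>" "\<alpha> < 1 / 2" "s * \<alpha> < 1"
    "\<And>x y z. \<lbrakk>x \<in> X; y \<in> X; z \<in> X; x \<noteq> y; y \<noteq> z; x \<noteq> z\<rbrakk> \<Longrightarrow>
       d (T x) (T y) + d (T y) (T z) \<le> \<alpha> * (d x (T x) + d y (T y) + d z (T z))"
    using paired_Kannan_constant[OF assms(1,4,5)] by blast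
  interpret paired_Kannan_map s \<alpha> X d T
    by (rule paired_Kannan_map.intro[OF assms(1,4) \<alpha>])
  have "prime_period_2_points X T = {}" if "fixed_points X T \<noteq> {}"
    using that no_period_2_if_fixed_point
    unfolding fixed_points_def prime_period_2_points_def by blast
  moreover have "fixed_points X T \<noteq> {}" if "prime_period_2_points X T = {}"
    using that fixed_point_if_no_period_2[OF assms(2)]
    unfolding fixed_points_def prime_period_2_points_def by blast
  ultimately show ?thesis using fixed_points_at_most_two by blast
qed

end
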